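(* Let $a_1,\dots,a_r,b_1,\dots,b_s\in\mathbb{C}$ and $q\in\mathbb{C}$ with $0<|q|<1$, such that $b_jq^k\neq 1$ for all $j$ and all $k\ge1$. Define polynomials $\alpha_r,\beta_s$ by $(1-a_1X)\cdots(1-a_rX)=1-\alpha_r(X)X$ and $(1-b_1X)\cdots(1-b_sX)=1-\beta_s(X)X$. Let $$t_n:=\frac{(a_1q,a_2q,\dots,a_rq;q)_n}{(b_1q,b_2q,\dots,b_sq;q)_n},\qquad s_N:=\sum_{n=0}^{N}(-1)^n t_n,$$ and let $\widetilde{\Phi}_{+}:=\lim_{N\to\infty}s_{2N+1}$, $\widetilde{\Phi}_{-}:=\lim_{N\to\infty}s_{2N}$. Then these limits exist and $$2\widetilde{\Phi}_{\pm}\pm\frac{(a_1q,\dots,a_rq;q)_\infty}{(b_1q,\dots,b_sq;q)_\infty}=1-\sum_{n=1}^{\infty}\frac{(-1)^nq^n\left(\alpha_r(q^n)-\beta_s(q^n)\right)(a_1q,\dots,a_rq;q)_{n-1}}{(b_1q,\dots,b_sq;q)_n},$$ where the upper signs go together and the lower signs go together.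
   Context: The $q$-Pochhammer symbol is $(a;q)_0:=1$, $(a;q)_n:=\prod_{j=0}^{n-1}(1-aq^j)$, $(a;q)_\infty:=\lim_{n\to\infty}(a;q)_n$ for $|q|<1$, and $(a_1,\dots,a_r;q)_n:=(a_1;q)_n\cdots(a_r;q)_n$ (similarly for $n=\infty$). The series $\sum_{n\ge0}(-1)^nt_n$ is denoted $\widetilde{\Phi}(a_1,\dots,a_r;b_1,\dots,b_s;q)$; $\widetilde{\Phi}_+$ (resp. $\widetilde{\Phi}_-$) is the limit of partial sums ending at an odd (resp. even) index. *)

theory Defs
  imports "HOL-Analysis.Analysis" "HOL-Computational_Algebra.Polynomial"
begin

definition qpoch :: "complex \<Rightarrow> complex \<Rightarrow> nat \<Rightarrow> complex" where
  "qpoch a q n = (\<Prod>j<n. 1 - a * q ^ j)"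

text \<open>The limit exists whenever \<open>norm q < 1\<close>; see \<open>qpoch_convergent\<close> below.\<close>

definition qpoch_inf :: "complex \<Rightarrow> complex \<Rightarrow> complex" where
  "qpoch_inf a q = lim (\<lambda>n. qpoch a q n)"

text \<open>Parameter families \<open>a\<^sub>1, \<dots>, a\<^sub>r\<close> are functions on \<open>nat\<close> of which only the
  values at \<open>1, \<dots>, r\<close> are used.\<close>

definition qpochs :: "(nat \<Rightarrow> complex) \<Rightarrow> nat \<Rightarrow> complex \<Rightarrow> nat \<Rightarrow> complex" where
  "qpochs a r q n = (\<Prod>j=1..r. qpoch (a j) q n)"

definition qpochs_inf :: "(nat \<Rightarrow> complex) \<Rightarrow> nat \<Rightarrow> complex \<Rightarrow> complex" where
  "qpochs_inf a r q = (\<Prod>j=1..r. qpoch_inf (a j) q)"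

definition phi_term ::
  "(nat \<Rightarrow> complex) \<Rightarrow> nat \<Rightarrow> (nat \<Rightarrow> complex) \<Rightarrow> nat \<Rightarrow> complex \<Rightarrow> nat \<Rightarrow> complex" where
  "phi_term a r b s q n = qpochs (\<lambda>j. a j * q) r q n / qpochs (\<lambda>j. b j * q) s q n"

definition phi_psum ::
  "(nat \<Rightarrow> complex) \<Rightarrow> nat \<Rightarrow> (nat \<Rightarrow> complex) \<Rightarrow> nat \<Rightarrow> complex \<Rightarrow> nat \<Rightarrow> complex" where
  "phi_psum a r b s q N = (\<Sum>n=0..N. (-1) ^ n * phi_term a r b s q n)"

definition phi_plus ::
  "(nat \<Rightarrow> complex) \<Rightarrow> nat \<Rightarrow> (nat \<Rightarrow> complex) \<Rightarrow> nat \<Rightarrow> complex \<Rightarrow> complex" where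
  "phi_plus a r b s q = lim (\<lambda>N. phi_psum a r b s q (2 * N + 1))"

definition phi_minus ::
  "(nat \<Rightarrow> complex) \<Rightarrow> nat \<Rightarrow> (nat \<Rightarrow> complex) \<Rightarrow> nat \<Rightarrow> complex \<Rightarrow> complex" where
  "phi_minus a r b s q = lim (\<lambda>N. phi_psum a r b s q (2 * N))"

lemma qpoch_convergent:
  assumes "norm q < 1"
  shows "convergent (\<lambda>n. qpoch a q n)"
proof -
  have "summable (\<lambda>j. norm a * norm q ^ j)"
    using assms by (intro summable_mult summable_geometric) auto
  hence "summable (\<lambda>j. norm ((1 - a * q ^ j) - 1))"
    by (simp add: norm_mult norm_power)
  hence "convergent_prod (\<lambda>j. 1 - a * q ^ j)"
    by (intro abs_convergent_prod_imp_convergent_prod summable_imp_abs_convergent_prod)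
  hence "convergent (\<lambda>n. \<Prod>j\<le>n. 1 - a * q ^ j)"
    by (rule convergent_prod_imp_convergent)
  hence "convergent (\<lambda>n. qpoch a q (Suc n))"
    by (simp add: qpoch_def lessThan_Suc_atMost)
  thus ?thesis
    by (subst (asm) convergent_Suc_iff)
qed

text \<open>The equation \<open>(1 - a\<^sub>1 X) \<cdots> (1 - a\<^sub>r X) = 1 - \<alpha>(X) X\<close> determines the
  polynomial \<open>\<alpha>\<close>.\<close>

lemma ex1_alpha_poly:
  fixes a :: "nat \<Rightarrow> complex"
  shows "\<exists>!\<alpha>. (\<Prod>j=1..r. [:1, - a j:]) = 1 - \<alpha> * [:0, 1:]"
proof -
  let ?p = "1 - (\<Prod>j=1..r. [:1, - a j:])"
  have "poly ?p 0 = 0"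
    by (simp add: poly_prod)
  hence "[:0, 1:] dvd ?p"
    using poly_eq_0_iff_dvd[of ?p 0] by simp
  then obtain \<alpha> where \<alpha>: "?p = [:0, 1:] * \<alpha>" ..
  have iff: "(\<Prod>j=1..r. [:1, - a j:]) = 1 - \<beta> * [:0, 1:] \<longleftrightarrow> \<beta> * [:0, 1:] = ?p" for \<beta>
    by (auto simp: algebra_simps)
  show ?thesis
  proof (rule ex1I)
    show "(\<Prod>j=1..r. [:1, - a j:]) = 1 - \<alpha> * [:0, 1:]"
      unfolding iff \<alpha> by (rule mult.commute)
  next
    fix \<beta> assume "(\<Prod>j=1..r. [:1, - a j:]) = 1 - \<beta> * [:0, 1:]"
    hence "\<beta> * [:0, 1:] = \<alpha> * [:0, 1:]"
      unfolding iff \<alpha> by (simp only: mult.commute)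
    thus "\<beta> = \<alpha>"
      by (subst (asm) mult_right_cancel) auto
  qed
qed

end

theory Submission
  imports Defs
begin

text \<open>The terms \<open>t\<^sub>n\<close> satisfy \<open>u\<^sub>n = -(-1)\<^sup>n (t\<^sub>n - t\<^sub>n\<^sub>-\<^sub>1)\<close>, so by telescoping
  \<open>1 - (u\<^sub>1 + \<dots> + u\<^sub>N) = 2 s\<^sub>N - (-1)\<^sup>N t\<^sub>N\<close>. The series of the \<open>u\<^sub>n\<close> is dominated by a
  geometric series and \<open>t\<^sub>N\<close> tends to the quotient of infinite products, so \<open>N\<close> may
  tend to infinity along either parity class.\<close>

lemma qpoch_LIMSEQ:
  assumes "norm q < 1"
  shows "(\<lambda>n. qpoch a q n) \<longlonglongrightarrow> qpoch_inf a q"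
  using qpoch_convergent[OF assms] unfolding qpoch_inf_def by (simp add: convergent_LIMSEQ_iff)

text \<open>Nonzero partial products alone could still tend to 0. Here the deviations of the factors
  from 1 are dominated by a geometric series, so the product converges absolutely, and such a
  product vanishes only if one of its factors does.\<close>

lemma qpoch_inf_nonzero:
  assumes "norm q < 1" and nz: "\<And>k. a * q ^ k \<noteq> 1"
  shows "qpoch_inf a q \<noteq> 0"
proof -
  have "summable (\<lambda>j. norm a * norm q ^ j)"
    using assms by (intro summable_mult summable_geometric) auto
  hence "summable (\<lambda>j. norm ((1 - a * q ^ j) - 1))"
    by (simp add: norm_mult norm_power)
  hence conv: "convergent_prod (\<lambda>j. 1 - a * q ^ j)"
    by (intro abs_convergent_prod_imp_convergent_prod summable_imp_abs_convergent_prod)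
  \<comment> \<open>The shift to \<open>Suc n\<close> matches the inclusive range of indices in the
    partial products that converge to \<open>prodinf\<close>.\<close>
  have "(\<lambda>n. qpoch a q (Suc n)) \<longlonglongrightarrow> prodinf (\<lambda>j. 1 - a * q ^ j)"
    using convergent_prod_LIMSEQ[OF conv] by (simp add: qpoch_def lessThan_Suc_atMost)
  moreover have "(\<lambda>n. qpoch a q (Suc n)) \<longlonglongrightarrow> qpoch_inf a q"
    using qpoch_LIMSEQ[OF assms(1)] by (rule LIMSEQ_Suc)
  ultimately have "qpoch_inf a q = prodinf (\<lambda>j. 1 - a * q ^ j)"
    by (metis LIMSEQ_unique)
  moreover have "prodinf (\<lambda>j. 1 - a * q ^ j) \<noteq> 0"
    using nz by (intro prodinf_nonzero conv) (metis eq_iff_diff_eq_0)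
  ultimately show ?thesis by simp
qed

lemma qpochs_LIMSEQ:
  assumes "norm q < 1"
  shows "(\<lambda>n. qpochs a r q n) \<longlonglongrightarrow> qpochs_inf a r q"
  unfolding qpochs_def qpochs_inf_def by (intro tendsto_prod qpoch_LIMSEQ assms)

lemma qpochs_0 [simp]: "qpochs a r q 0 = 1"
  by (simp add: qpochs_def qpoch_def)

lemma qpochs_Suc: "qpochs a r q (Suc n) = qpochs a r q n * (\<Prod>j=1..r. 1 - a j * q ^ n)"
  by (simp add: qpochs_def qpoch_def prod.distrib)

text \<open>The factors gained at index \<open>n\<close> are 1 - a_j X at X =
  \<open>q ^ Suc n\<close>, so their product is the polynomial defining \<alpha>, evaluated at that
  X.\<close>

lemma qpochs_Suc_shifted:
  assumes "(\<Prod>j=1..r. [:1, - a j:]) = 1 - \<alpha> * [:0, 1:]"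
  shows "qpochs (\<lambda>j. a j * q) r q (Suc n)
    = qpochs (\<lambda>j. a j * q) r q n * (1 - poly \<alpha> (q ^ Suc n) * q ^ Suc n)"
proof -
  have "(\<Prod>j=1..r. 1 - a j * q * q ^ n) = poly (\<Prod>j=1..r. [:1, - a j:]) (q ^ Suc n)"
    by (simp add: poly_prod mult_ac)
  also have "\<dots> = 1 - poly \<alpha> (q ^ Suc n) * q ^ Suc n"
    unfolding assms by simp
  finally show ?thesis by (simp only: qpochs_Suc)
qed

lemma qpochs_nonzero:
  assumes "\<And>j k. 1 \<le> j \<Longrightarrow> j \<le> r \<Longrightarrow> a j * q ^ k \<noteq> 1"
  shows "qpochs a r q n \<noteq> 0"
  using assms by (auto simp: qpochs_def qpoch_def)

lemma qpochs_inf_nonzero: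
  assumes "norm q < 1" and "\<And>j k. 1 \<le> j \<Longrightarrow> j \<le> r \<Longrightarrow> a j * q ^ k \<noteq> 1"
  shows "qpochs_inf a r q \<noteq> 0"
  using assms by (auto simp: qpochs_inf_def qpoch_inf_nonzero)

text \<open>Summation by parts isolates the oscillating boundary term \<open>(-1) ^ N * t N\<close>;
  what remains is a sum of differences, which can converge even if \<open>t\<close> does not tend to
  0.\<close>

lemma alternating_sum_by_parts:
  fixes t :: "nat \<Rightarrow> complex"
  shows "2 * (\<Sum>n=0..N. (-1) ^ n * t n)
    = t 0 + (-1) ^ N * t N + (\<Sum>n<N. (-1) ^ Suc n * (t (Suc n) - t n))"
  by (induction N) (simp_all add: algebra_simps)

theorem theorem3:
  fixes r s :: nat
    and a b :: "nat \<Rightarrow> complex"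
    and q :: complex
    and \<alpha> \<beta> :: "complex poly"
  assumes "0 < norm q" and "norm q < 1"
    and "\<And>j k. 1 \<le> j \<Longrightarrow> j \<le> s \<Longrightarrow> 1 \<le> k \<Longrightarrow> b j * q ^ k \<noteq> 1"
    and "(\<Prod>j=1..r. [:1, - a j:]) = 1 - \<alpha> * [:0, 1:]"
    and "(\<Prod>j=1..s. [:1, - b j:]) = 1 - \<beta> * [:0, 1:]"
  defines "A \<equiv> \<lambda>j. a j * q"
    and "B \<equiv> \<lambda>j. b j * q"
  defines "u \<equiv> \<lambda>n. (-1) ^ n * q ^ n * (poly \<alpha> (q ^ n) - poly \<beta> (q ^ n))
                    * qpochs A r q (n - 1) / qpochs B s q n"
  shows "convergent (\<lambda>N. phi_psum a r b s q (2 * N + 1))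
    \<and> convergent (\<lambda>N. phi_psum a r b s q (2 * N))
    \<and> summable (\<lambda>n. u (Suc n))
    \<and> 2 * phi_plus a r b s q + qpochs_inf A r q / qpochs_inf B s q = 1 - (\<Sum>n. u (Suc n))
    \<and> 2 * phi_minus a r b s q - qpochs_inf A r q / qpochs_inf B s q = 1 - (\<Sum>n. u (Suc n))"
proof -
  let ?S = "phi_psum a r b s q"
  define t where "t = phi_term a r b s q"
  define T where "T = qpochs_inf A r q / qpochs_inf B s q"
  define U where "U = (\<Sum>n. u (Suc n))"
  note q = assms(2)
  \<comment> \<open>\<open>B j\<close> already carries one factor \<open>q\<close>, so the exponent
    \<open>k\<close> here is \<open>Suc k\<close> in the hypothesis on \<open>b\<close>, and
    \<open>k = 0\<close> is covered.\<close>
  have Bq: "B j * q ^ k \<noteq> 1" if "1 \<le> j" "j \<le> s" for j k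
    using assms(3)[of j "Suc k"] that by (simp add: B_def mult_ac)
  have B_nz: "qpochs B s q n \<noteq> 0" for n
    using Bq by (rule qpochs_nonzero)
  have Binf_nz: "qpochs_inf B s q \<noteq> 0"
    using q Bq by (rule qpochs_inf_nonzero)
  have t_eq: "t n = qpochs A r q n / qpochs B s q n" for n
    by (simp add: t_def phi_term_def A_def B_def)
  have t_lim: "t \<longlonglongrightarrow> T"
    unfolding t_eq[abs_def] T_def by (intro tendsto_divide qpochs_LIMSEQ q Binf_nz)

  have u_eq: "u (Suc n) = - ((-1) ^ Suc n * (t (Suc n) - t n))" for n
  proof -
    have A_Suc: "qpochs A r q (Suc n) = qpochs A r q n * (1 - poly \<alpha> (q ^ Suc n) * q ^ Suc n)"
      unfolding A_def by (rule qpochs_Suc_shifted) (rule assms(4))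
    have B_Suc: "qpochs B s q (Suc n) = qpochs B s q n * (1 - poly \<beta> (q ^ Suc n) * q ^ Suc n)"
      unfolding B_def by (rule qpochs_Suc_shifted) (rule assms(5))
    \<comment> \<open>Over the denominator of \<open>t (Suc n)\<close>, the 1s in the two new
      factors cancel in the difference, leaving \<alpha> - \<beta>. The factor put into numerator
      and denominator is nonzero because it divides \<open>qpochs B s q (Suc n)\<close>.\<close>
    have t_n: "t n = qpochs A r q n * (1 - poly \<beta> (q ^ Suc n) * q ^ Suc n) / qpochs B s q (Suc n)"
      using B_nz[of n] B_nz[of "Suc n"] by (simp add: t_eq B_Suc del: power_Suc)
    have "t (Suc n) - t n = (qpochs A r q n * (1 - poly \<alpha> (q ^ Suc n) * q ^ Suc n)
        - qpochs A r q n * (1 - poly \<beta> (q ^ Suc n) * q ^ Suc n)) / qpochs B s q (Suc n)"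
      by (simp only: t_n t_eq[of "Suc n"] A_Suc diff_divide_distrib)
    also have "\<dots> = - (q ^ Suc n * (poly \<alpha> (q ^ Suc n) - poly \<beta> (q ^ Suc n))
        * qpochs A r q n) / qpochs B s q (Suc n)"
      by (rule arg_cong2[where f = "(/)"]) (simp_all only: algebra_simps minus_diff_eq)
    finally have "t (Suc n) - t n = - (q ^ Suc n * (poly \<alpha> (q ^ Suc n) - poly \<beta> (q ^ Suc n))
        * qpochs A r q n) / qpochs B s q (Suc n)" .
    thus ?thesis by (simp add: u_def del: power_Suc)
  qed

  have u_summable: "summable (\<lambda>n. u (Suc n))"
  proof -
    \<comment> \<open>\<open>c n\<close> is \<open>u (Suc n)\<close> without its sign and its power
      of \<open>q\<close>. It converges, hence is bounded, and that power supplies the geometric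
      decay.\<close>
    define c where "c n = (poly \<alpha> (q ^ Suc n) - poly \<beta> (q ^ Suc n))
        * qpochs A r q n / qpochs B s q (Suc n)" for n
    have "(\<lambda>n. q ^ Suc n) \<longlonglongrightarrow> 0"
      using q by (intro LIMSEQ_Suc LIMSEQ_power_zero)
    hence "c \<longlonglongrightarrow> (poly \<alpha> 0 - poly \<beta> 0) * qpochs_inf A r q / qpochs_inf B s q"
      unfolding c_def
      by (intro tendsto_intros qpochs_LIMSEQ q Binf_nz LIMSEQ_Suc[OF qpochs_LIMSEQ])
    hence "Bseq c" by (intro convergent_imp_Bseq convergentI)
    then obtain K where K: "\<And>n. norm (c n) \<le> K" by (auto simp: Bseq_def)
    have u_le: "norm (u (Suc n)) \<le> K * norm q ^ Suc n" for n
    proof -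
      have "u (Suc n) = (-1) ^ Suc n * q ^ Suc n * c n"
        by (simp add: u_def c_def del: power_Suc)
      hence "norm (u (Suc n)) = norm (c n) * norm q ^ Suc n"
        by (simp add: norm_mult norm_power)
      thus ?thesis using K[of n] by (simp add: mult_right_mono del: power_Suc)
    qed
    have "summable (\<lambda>n. K * norm q ^ Suc n)"
      using q summable_geometric[of "norm q"]
      by (intro summable_mult) (simp add: summable_Suc_iff del: power_Suc)
    thus ?thesis
      by (rule summable_comparison_test'[where N = 0]) (rule u_le)
  qed

  \<comment> \<open>The 1 is \<open>t 0\<close>, a quotient of empty products; the minus sign comes
    from \<open>u_eq\<close>.\<close>
  have psum_eq: "?S N = (1 - (\<Sum>n<N. u (Suc n)) + (-1) ^ N * t N) / 2" for N
    using alternating_sum_by_parts[of t N]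
    by (simp add: phi_psum_def t_def[symmetric] t_eq[of 0] u_eq sum_negf mult.commute add_ac del: power_Suc)
  have U_lim: "(\<lambda>N. \<Sum>n<N. u (Suc n)) \<longlonglongrightarrow> U"
    using u_summable unfolding U_def by (rule summable_LIMSEQ)

  \<comment> \<open>Along each parity class \<open>(-1) ^ N\<close> is constant, so the boundary
    term tends to \<open>- T\<close> for odd and to \<open>T\<close> for even indices.\<close>
  have "strict_mono (\<lambda>N::nat. 2 * N + 1)" "strict_mono (\<lambda>N::nat. 2 * N)"
    by (auto simp: strict_mono_def)
  note sub = this[THEN LIMSEQ_subseq_LIMSEQ[rotated], unfolded o_def]
  have "(\<lambda>N. ?S (2 * N + 1)) \<longlonglongrightarrow> (1 - U - T) / 2"
    unfolding psum_eq using sub(1)[OF U_lim] sub(1)[OF t_lim]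
    by (auto intro!: tendsto_intros)
  moreover have "(\<lambda>N. ?S (2 * N)) \<longlonglongrightarrow> (1 - U + T) / 2"
    unfolding psum_eq using sub(2)[OF U_lim] sub(2)[OF t_lim]
    by (auto intro!: tendsto_intros)
  ultimately show ?thesis
    using u_summable
    by (simp add: phi_plus_def phi_minus_def limI convergentI diff_divide_distrib add_divide_distrib flip: T_def U_def)
qed

end
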